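(* For any $r \in 2^\omega$ and $n \in \omega$, the following are equivalent: (1) There is a $\Delta^1_{n+1}(r)$ ultrafilter. (2) There is a $\Pi^1_n(r)$ ultrafilter base, i.e. a $\Pi^1_n(r)$ set that is a base for some ultrafilter.
   Context: Filters are filters on $\omega$ containing all cofinite sets and not containing $\emptyset$; an ultrafilter is a maximal such filter. Subsets of $\omega$ are identified with elements of $2^\omega$ via characteristic functions, and definability of sets of subsets of $\omega$ is in the sense of effective descriptive set theory; $\Pi^1_n(r)$ and $\Delta^1_{n+1}(r)$ are the projective pointclasses relativized to the parameter $r$. A base for an ultrafilter $\mathcal{U}$ is a set $X \subseteq \mathcal{U}$ such that every $u \in \mathcal{U}$ has a subset $x \subseteq u$ with $x \in X$. The ultrafilters in (1) and (2) are not required to be the same. *)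

theory Defs
  imports Complex_Main "HOL-Library.Indicator_Function"
begin

text \<open>
  The lightface projective pointclasses are defined by formulas of second-order arithmetic,
  interpreted in the standard two-sorted structure with number variables ranging over \<open>\<omega>\<close>
  and function variables ranging over the whole Baire space \<open>\<omega>\<^sup>\<omega>\<close>; the primitives are
  \<open>0, 1, +, \<cdot>, exp, =, <\<close> and application of a function variable.
  Variables of either sort are named by natural numbers.
\<close>

datatype tm =
    NVar nat
  | Zero
  | One
  | Add tm tm
  | Mul tm tm
  | Exp tm tm
  | App nat tm

datatype fm =
    Eq tm tm
  | Less tm tm
  | Neg fm
  | Conj fm fm
  | ExN nat fm
  | AllN nat fm
  | ExF nat fm
  | AllF nat fm

primrec tm_val :: "(nat \<Rightarrow> nat) \<Rightarrow> (nat \<Rightarrow> nat \<Rightarrow> nat) \<Rightarrow> tm \<Rightarrow> nat" where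
  "tm_val v F (NVar i) = v i"
| "tm_val v F Zero = 0"
| "tm_val v F One = 1"
| "tm_val v F (Add s t) = tm_val v F s + tm_val v F t"
| "tm_val v F (Mul s t) = tm_val v F s * tm_val v F t"
| "tm_val v F (Exp s t) = tm_val v F s ^ tm_val v F t"
| "tm_val v F (App i t) = F i (tm_val v F t)"

primrec sat :: "(nat \<Rightarrow> nat) \<Rightarrow> (nat \<Rightarrow> nat \<Rightarrow> nat) \<Rightarrow> fm \<Rightarrow> bool" where
  "sat v F (Eq s t) \<longleftrightarrow> tm_val v F s = tm_val v F t"
| "sat v F (Less s t) \<longleftrightarrow> tm_val v F s < tm_val v F t"
| "sat v F (Neg \<phi>) \<longleftrightarrow> \<not> sat v F \<phi>"
| "sat v F (Conj \<phi> \<psi>) \<longleftrightarrow> sat v F \<phi> \<and> sat v F \<psi>"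
| "sat v F (ExN i \<phi>) \<longleftrightarrow> (\<exists>m. sat (v(i := m)) F \<phi>)"
| "sat v F (AllN i \<phi>) \<longleftrightarrow> (\<forall>m. sat (v(i := m)) F \<phi>)"
| "sat v F (ExF i \<phi>) \<longleftrightarrow> (\<exists>f. sat v (F(i := f)) \<phi>)"
| "sat v F (AllF i \<phi>) \<longleftrightarrow> (\<forall>f. sat v (F(i := f)) \<phi>)"

primrec arithmetical :: "fm \<Rightarrow> bool" where
  "arithmetical (Eq s t) \<longleftrightarrow> True"
| "arithmetical (Less s t) \<longleftrightarrow> True"
| "arithmetical (Neg \<phi>) \<longleftrightarrow> arithmetical \<phi>"
| "arithmetical (Conj \<phi> \<psi>) \<longleftrightarrow> arithmetical \<phi> \<and> arithmetical \<psi>"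
| "arithmetical (ExN i \<phi>) \<longleftrightarrow> arithmetical \<phi>"
| "arithmetical (AllN i \<phi>) \<longleftrightarrow> arithmetical \<phi>"
| "arithmetical (ExF i \<phi>) \<longleftrightarrow> False"
| "arithmetical (AllF i \<phi>) \<longleftrightarrow> False"

text \<open>
  Level \<open>n\<close> consists of \<open>n\<close> alternating function quantifiers in front of an arithmetical matrix;
  in particular \<open>\<Sigma>\<^sup>1\<^sub>0 = \<Pi>\<^sup>1\<^sub>0\<close> are the arithmetical formulas.
\<close>

inductive Sigma1_fm :: "nat \<Rightarrow> fm \<Rightarrow> bool" and Pi1_fm :: "nat \<Rightarrow> fm \<Rightarrow> bool" where
  "arithmetical \<phi> \<Longrightarrow> Sigma1_fm 0 \<phi>"
| "arithmetical \<phi> \<Longrightarrow> Pi1_fm 0 \<phi>"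
| "Pi1_fm n \<phi> \<Longrightarrow> Sigma1_fm (Suc n) (ExF i \<phi>)"
| "Sigma1_fm n \<phi> \<Longrightarrow> Pi1_fm (Suc n) (AllF i \<phi>)"

text \<open>
  \<open>defining_fm \<phi> r A\<close>: \<open>A = {x. \<phi>(x, r)}\<close>, where function variable 0 denotes \<open>x\<close> and function
  variable 1 denotes \<open>r\<close>, both given by their characteristic functions. Quantifying over all
  assignments of the other variables prevents them from acting as further parameters.
\<close>

definition defining_fm :: "fm \<Rightarrow> nat set \<Rightarrow> nat set set \<Rightarrow> bool" where
  "defining_fm \<phi> r A \<longleftrightarrow>
     (\<forall>x v F. F 0 = indicator x \<and> F 1 = indicator r \<longrightarrow> (x \<in> A \<longleftrightarrow> sat v F \<phi>))"

definition Sigma1 :: "nat \<Rightarrow> nat set \<Rightarrow> nat set set set" where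
  "Sigma1 n r = {A. \<exists>\<phi>. Sigma1_fm n \<phi> \<and> defining_fm \<phi> r A}"

definition Pi1 :: "nat \<Rightarrow> nat set \<Rightarrow> nat set set set" where
  "Pi1 n r = {A. \<exists>\<phi>. Pi1_fm n \<phi> \<and> defining_fm \<phi> r A}"

definition Delta1 :: "nat \<Rightarrow> nat set \<Rightarrow> nat set set set" where
  "Delta1 n r = Sigma1 n r \<inter> Pi1 n r"

text \<open>
  Since the pointclasses consist of sets of subsets of \<open>\<omega>\<close>, filters are represented by such sets
  rather than by the type \<^typ>\<open>nat filter\<close>; \<^const>\<open>is_filter\<close> is the predicate carving out that type.
\<close>

definition omega_filter :: "nat set set \<Rightarrow> bool" where
  "omega_filter U \<longleftrightarrow>
     is_filter (\<lambda>P. Collect P \<in> U) \<and> (\<forall>x. finite (- x) \<longrightarrow> x \<in> U) \<and> {} \<notin> U"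

definition omega_ultrafilter :: "nat set set \<Rightarrow> bool" where
  "omega_ultrafilter U \<longleftrightarrow>
     omega_filter U \<and> (\<forall>V. omega_filter V \<and> U \<subseteq> V \<longrightarrow> V = U)"

definition ultrafilter_base :: "nat set set \<Rightarrow> nat set set \<Rightarrow> bool" where
  "ultrafilter_base X U \<longleftrightarrow>
     omega_ultrafilter U \<and> X \<subseteq> U \<and> (\<forall>u\<in>U. \<exists>x\<in>X. x \<subseteq> u)"

end

theory Submission
  imports Defs "HOL-Library.Infinite_Set" "HOL-Library.Nat_Bijection"
begin

text \<open>
  Let \<open>X\<close> be a \<open>\<Pi>\<^sup>1\<^sub>n(r)\<close> base of an ultrafilter \<open>U\<close>. Then \<open>u \<in> U\<close> holds iff some \<open>x \<in> X\<close> is contained in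
  \<open>u\<close>, and iff no \<open>x \<in> X\<close> is contained in the complement of \<open>u\<close>; this makes \<open>U\<close> itself \<open>\<Delta>\<^sup>1\<^sub>n\<^sub>+\<^sub>1(r)\<close>
  (\<open>Delta1_of_Pi1_base\<close>).

  Conversely, let \<open>U\<close> be a \<open>\<Delta>\<^sup>1\<^sub>n\<^sub>+\<^sub>1(r)\<close> ultrafilter, so that \<open>u \<in> U\<close> iff \<open>\<exists>f. \<psi>(u, f, r)\<close> for some \<open>\<psi>\<close> in
  \<open>\<Pi>\<^sup>1\<^sub>n\<close>. One would like to form a base of those sets that code, by their own shape, a witness \<open>f\<close> for
  their membership. A member of \<open>U\<close> offers no evident room for such a code, but a member of the Fubini square
  \<open>{x. {a. x\<^sub>a \<in> U} \<in> U}\<close> does, where \<open>x\<^sub>a\<close> is the \<open>a\<close>-th column of \<open>x \<subseteq> \<omega> \<times> \<omega>\<close> and \<open>\<omega> \<times> \<omega>\<close> is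
  identified with \<open>\<omega>\<close> by a pairing function. From each column
  finitely many points can be removed without leaving the ultrafilter. In this way the number of
  points of one nonempty column below the least point of the next one can be prescribed at will, so
  that every member of the Fubini square contains one coding an arbitrary \<open>h : \<omega> \<rightarrow> \<omega>\<close>
  (\<open>thin_to_code\<close>). Moreover \<open>h\<close> is arithmetical in the set (\<open>arith_fun_decode\<close>).

  Now take all \<open>x\<close> for which the coded function supplies sets \<open>Y\<^sub>0, Y\<^sub>1, \<dots>\<close> and functions \<open>g\<^sub>i\<close> with
  \<open>\<psi>(Y\<^sub>i, g\<^sub>i, r)\<close> for all \<open>i\<close>, such that \<open>Y\<^sub>a\<^sub>+\<^sub>1\<close> is almost contained in \<open>x\<^sub>a\<close> whenever \<open>a \<in> Y\<^sub>0\<close>. Such an \<open>x\<close>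
  belongs to the Fubini square, and the previous remark shows that these \<open>x\<close> form a base of it
  (\<open>coded_base_fubini_square\<close>). They form a \<open>\<Pi>\<^sup>1\<^sub>n(r)\<close> set because the number quantifier over \<open>i\<close> can be
  absorbed into the leading function quantifier of \<open>\<psi>\<close> (\<open>coded_base_Pi1\<close>). The argument is uniform
  in \<open>n\<close>, including the arithmetical level \<open>n = 0\<close>.

  Definability is handled semantically. Relations and functions on environments of functions are
  called arithmetical if a formula defines them, and closure under minimization and
  primitive recursion is shown once. The projective levels are then generated from arithmetical
  relations by quantifiers with de Bruijn indices, which are closed under arithmetical
  substitution (\<open>pi_rel_comp\<close>).
\<close>

section \<open>Instantiating the function variables of arithmetical formulas\<close>

type_synonym fenv = "nat \<Rightarrow> nat \<Rightarrow> nat"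

abbreviation (input) shift :: "fenv \<Rightarrow> fenv" where
  "shift F \<equiv> (\<lambda>i. F (Suc i))"

text \<open>
  Relations are predicates of function environments alone. A number parameter is passed as a
  function variable of which only the value at \<open>0\<close> is read, so that a single kind of environment,
  extended by \<open>case_nat\<close> and truncated by \<open>shift\<close>, serves both sorts and no variable
  names have to be managed.
\<close>
definition arith_rel :: "(fenv \<Rightarrow> bool) \<Rightarrow> bool" where
  "arith_rel P \<longleftrightarrow> (\<exists>\<phi>. arithmetical \<phi> \<and> (\<forall>v F. sat v F \<phi> \<longleftrightarrow> P F))"

text \<open>
  \<open>tm_inst \<theta>\<close> replaces every application \<open>App i t\<close> by \<open>\<theta> i t\<close>. Two instances matter: renaming
  function variables, and reading function variable \<open>0\<close> as a constant function whose value is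
  held by a number variable.
\<close>
primrec tm_inst :: "(nat \<Rightarrow> tm \<Rightarrow> tm) \<Rightarrow> tm \<Rightarrow> tm" where
  "tm_inst \<theta> (NVar i) = NVar i"
| "tm_inst \<theta> Zero = Zero"
| "tm_inst \<theta> One = One"
| "tm_inst \<theta> (Add s t) = Add (tm_inst \<theta> s) (tm_inst \<theta> t)"
| "tm_inst \<theta> (Mul s t) = Mul (tm_inst \<theta> s) (tm_inst \<theta> t)"
| "tm_inst \<theta> (Exp s t) = Exp (tm_inst \<theta> s) (tm_inst \<theta> t)"
| "tm_inst \<theta> (App i t) = \<theta> i (tm_inst \<theta> t)"

primrec fm_inst :: "(nat \<Rightarrow> tm \<Rightarrow> tm) \<Rightarrow> fm \<Rightarrow> fm" where
  "fm_inst \<theta> (Eq s t) = Eq (tm_inst \<theta> s) (tm_inst \<theta> t)"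
| "fm_inst \<theta> (Less s t) = Less (tm_inst \<theta> s) (tm_inst \<theta> t)"
| "fm_inst \<theta> (Neg \<phi>) = Neg (fm_inst \<theta> \<phi>)"
| "fm_inst \<theta> (Conj \<phi> \<psi>) = Conj (fm_inst \<theta> \<phi>) (fm_inst \<theta> \<psi>)"
| "fm_inst \<theta> (ExN i \<phi>) = ExN i (fm_inst \<theta> \<phi>)"
| "fm_inst \<theta> (AllN i \<phi>) = AllN i (fm_inst \<theta> \<phi>)"
| "fm_inst \<theta> (ExF i \<phi>) = ExF i (fm_inst \<theta> \<phi>)"
| "fm_inst \<theta> (AllF i \<phi>) = AllF i (fm_inst \<theta> \<phi>)"

lemma arithmetical_fm_inst [simp]: "arithmetical (fm_inst \<theta> \<phi>) \<longleftrightarrow> arithmetical \<phi>"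
  by (induction \<phi>) auto

lemma tm_val_inst:
  assumes "\<And>i t. tm_val v F (\<theta> i t) = G i (tm_val v F t)"
  shows "tm_val v F (tm_inst \<theta> s) = tm_val v G s"
  by (induction s) (auto simp: assms)

text \<open>
  The environment in which the original formula is to be read may depend on the value of one number
  variable \<open>j\<close>, because an instance of \<open>\<theta>\<close> may mention \<open>NVar j\<close>. This is harmless as long as \<open>j\<close> is not
  bound in the formula, which is true of all sufficiently large \<open>j\<close>. Saying \<open>eventually\<close> avoids
  computing sets of variables.
\<close>
definition inst_correct :: "nat \<Rightarrow> fm \<Rightarrow> bool" where
  "inst_correct j \<phi> \<longleftrightarrow> (\<forall>\<theta> F H.
     (\<forall>v i t. tm_val v F (\<theta> i t) = H (v j) i (tm_val v F t)) \<longrightarrow>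
     (\<forall>v. sat v F (fm_inst \<theta> \<phi>) \<longleftrightarrow> sat v (H (v j)) \<phi>))"

lemma inst_correctI:
  assumes "\<And>\<theta> F H v. (\<And>v i t. tm_val v F (\<theta> i t) = H (v j) i (tm_val v F t)) \<Longrightarrow>
    sat v F (fm_inst \<theta> \<phi>) \<longleftrightarrow> sat v (H (v j)) \<phi>"
  shows "inst_correct j \<phi>"
  using assms unfolding inst_correct_def by blast

lemma inst_correctD:
  assumes "inst_correct j \<phi>" "\<And>v i t. tm_val v F (\<theta> i t) = H (v j) i (tm_val v F t)"
  shows "sat v F (fm_inst \<theta> \<phi>) \<longleftrightarrow> sat v (H (v j)) \<phi>"
  using assms unfolding inst_correct_def by blast

lemma eventually_inst_correct:
  assumes "arithmetical \<phi>"
  shows "\<forall>\<^sub>F j in sequentially. inst_correct j \<phi>"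
  using assms
proof (induction \<phi>)
  case (Eq s t)
  show ?case
    by (intro always_eventually allI inst_correctI) (simp add: tm_val_inst)
next
  case (Less s t)
  show ?case
    by (intro always_eventually allI inst_correctI) (simp add: tm_val_inst)
next
  case (Neg \<phi>)
  then have "\<forall>\<^sub>F j in sequentially. inst_correct j \<phi>" by simp
  then show ?case
  proof eventually_elim
    case (elim j)
    show ?case
    proof (rule inst_correctI)
      fix \<theta> F and H :: \<open>nat \<Rightarrow> fenv\<close> and v assume "\<And>v i t. tm_val v F (\<theta> i t) = H (v j) i (tm_val v F t)"
      from inst_correctD[OF elim this]
      show "sat v F (fm_inst \<theta> (Neg \<phi>)) \<longleftrightarrow> sat v (H (v j)) (Neg \<phi>)" by simp
    qed
  qed
next
  case (Conj \<phi> \<psi>)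
  then have "\<forall>\<^sub>F j in sequentially. inst_correct j \<phi>" "\<forall>\<^sub>F j in sequentially. inst_correct j \<psi>"
    by simp_all
  then show ?case
  proof eventually_elim
    case (elim j)
    show ?case
    proof (rule inst_correctI)
      fix \<theta> F and H :: \<open>nat \<Rightarrow> fenv\<close> and v assume "\<And>v i t. tm_val v F (\<theta> i t) = H (v j) i (tm_val v F t)"
      from inst_correctD[OF elim(1) this] inst_correctD[OF elim(2) this]
      show "sat v F (fm_inst \<theta> (Conj \<phi> \<psi>)) \<longleftrightarrow> sat v (H (v j)) (Conj \<phi> \<psi>)" by simp
    qed
  qed
next
  case (ExN i \<phi>)
  then have "\<forall>\<^sub>F j in sequentially. inst_correct j \<phi>" by simp
  with eventually_gt_at_top[of i] show ?case
  proof eventually_elim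
    case (elim j)
    show ?case
    proof (rule inst_correctI)
      fix \<theta> F and H :: \<open>nat \<Rightarrow> fenv\<close> and v assume "\<And>v i t. tm_val v F (\<theta> i t) = H (v j) i (tm_val v F t)"
      from inst_correctD[OF elim(2) this] elim(1)
      show "sat v F (fm_inst \<theta> (ExN i \<phi>)) \<longleftrightarrow> sat v (H (v j)) (ExN i \<phi>)" by simp
    qed
  qed
next
  case (AllN i \<phi>)
  then have "\<forall>\<^sub>F j in sequentially. inst_correct j \<phi>" by simp
  with eventually_gt_at_top[of i] show ?case
  proof eventually_elim
    case (elim j)
    show ?case
    proof (rule inst_correctI)
      fix \<theta> F and H :: \<open>nat \<Rightarrow> fenv\<close> and v assume "\<And>v i t. tm_val v F (\<theta> i t) = H (v j) i (tm_val v F t)"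
      from inst_correctD[OF elim(2) this] elim(1)
      show "sat v F (fm_inst \<theta> (AllN i \<phi>)) \<longleftrightarrow> sat v (H (v j)) (AllN i \<phi>)" by simp
    qed
  qed
qed simp_all

lemma ex_inst_correct:
  assumes "arithmetical \<phi>"
  obtains j where "inst_correct j \<phi>"
  using eventually_inst_correct[OF assms] unfolding eventually_sequentially by blast

section \<open>Arithmetical relations and functions\<close>

lemma arith_rename:
  assumes "arith_rel P"
  shows "arith_rel (\<lambda>F. P (\<lambda>i. F (\<rho> i)))"
proof -
  obtain \<phi> where \<phi>: "arithmetical \<phi>" "\<And>v F. sat v F \<phi> \<longleftrightarrow> P F"
    using assms unfolding arith_rel_def by auto
  obtain j where j: "inst_correct j \<phi>"
    using ex_inst_correct[OF \<phi>(1)] .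
  have "sat v F (fm_inst (\<lambda>i. App (\<rho> i)) \<phi>) \<longleftrightarrow> sat v (\<lambda>i. F (\<rho> i)) \<phi>" for v F
    by (rule inst_correctD[OF j, where H = "\<lambda>_ i. F (\<rho> i)"]) simp
  then have "sat v F (fm_inst (\<lambda>i. App (\<rho> i)) \<phi>) \<longleftrightarrow> P (\<lambda>i. F (\<rho> i))" for v F
    by (simp add: \<phi>(2))
  then show ?thesis
    unfolding arith_rel_def using \<phi>(1) arithmetical_fm_inst by blast
qed

lemma arith_not:
  assumes "arith_rel P"
  shows "arith_rel (\<lambda>F. \<not> P F)"
  using assms unfolding arith_rel_def by (metis arithmetical.simps(3) sat.simps(3))

lemma arith_conj:
  assumes "arith_rel P" "arith_rel Q"
  shows "arith_rel (\<lambda>F. P F \<and> Q F)"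
  using assms unfolding arith_rel_def by (metis arithmetical.simps(4) sat.simps(4))

lemma arith_disj:
  assumes "arith_rel P" "arith_rel Q"
  shows "arith_rel (\<lambda>F. P F \<or> Q F)"
  using arith_not[OF arith_conj[OF arith_not[OF assms(1)] arith_not[OF assms(2)]]] by simp

lemma arith_imp:
  assumes "arith_rel P" "arith_rel Q"
  shows "arith_rel (\<lambda>F. P F \<longrightarrow> Q F)"
  using arith_disj[OF arith_not[OF assms(1)] assms(2)] by (simp only: imp_conv_disj)

text \<open>
  The number quantified over occupies position \<open>0\<close> of the environment; a fresh number variable is put
  in its place and then bound.
\<close>
lemma arith_ex:
  assumes "arith_rel (\<lambda>F. P (F 0 0) (shift F))"
  shows "arith_rel (\<lambda>F. \<exists>m. P m F)"
proof -
  obtain \<phi> where \<phi>: "arithmetical \<phi>" "\<And>v F. sat v F \<phi> \<longleftrightarrow> P (F 0 0) (shift F)"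
    using assms unfolding arith_rel_def by auto
  obtain j where j: "inst_correct j \<phi>"
    using ex_inst_correct[OF \<phi>(1)] .
  define \<theta> where "\<theta> i t = (case i of 0 \<Rightarrow> NVar j | Suc k \<Rightarrow> App k t)" for i t
  have "sat v F (fm_inst \<theta> \<phi>) \<longleftrightarrow> sat v (case_nat (\<lambda>_. v j) F) \<phi>" for v F
    by (rule inst_correctD[OF j, where H = "\<lambda>m. case_nat (\<lambda>_. m) F"]) (simp add: \<theta>_def split: nat.split)
  then have "sat v F (ExN j (fm_inst \<theta> \<phi>)) \<longleftrightarrow> (\<exists>m. P m F)" for v F
    by (simp add: \<phi>(2))
  moreover have "arithmetical (ExN j (fm_inst \<theta> \<phi>))"
    using \<phi>(1) by simp
  ultimately show ?thesis unfolding arith_rel_def by blast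
qed

lemma arith_all:
  assumes "arith_rel (\<lambda>F. P (F 0 0) (shift F))"
  shows "arith_rel (\<lambda>F. \<forall>m. P m F)"
  using arith_not[OF arith_ex[of "\<lambda>m F. \<not> P m F", OF arith_not[OF assms]]] by simp

text \<open>
  A function is arithmetical if its graph is; the value is passed at position \<open>0\<close>.
\<close>
definition arith_fun :: "(fenv \<Rightarrow> nat) \<Rightarrow> bool" where
  "arith_fun a \<longleftrightarrow> arith_rel (\<lambda>F. F 0 0 = a (shift F))"

lemma arith_rel_subst:
  assumes "arith_rel (\<lambda>F. P (F 0 0) (shift F))" "arith_fun a"
  shows "arith_rel (\<lambda>F. P (a F) F)"
proof -
  have "arith_rel (\<lambda>F. \<exists>m. m = a F \<and> P m F)"
    by (intro arith_ex arith_conj assms(1) assms(2)[unfolded arith_fun_def])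
  then show ?thesis by simp
qed

lemma arith_fun_rename:
  assumes "arith_fun a"
  shows "arith_fun (\<lambda>F. a (\<lambda>i. F (\<rho> i)))"
  using arith_rename[OF assms[unfolded arith_fun_def], of "case_nat 0 (\<lambda>i. Suc (\<rho> i))"]
  by (simp add: arith_fun_def)

lemma arith_fun_subst:
  assumes "arith_fun (\<lambda>F. c (F 0 0) (shift F))" "arith_fun a"
  shows "arith_fun (\<lambda>F. c (a F) F)"
proof -
  have "arith_rel (\<lambda>F. F 1 0 = c (F 0 0) (\<lambda>i. F (Suc (Suc i))))"
    using arith_rename[OF assms(1)[unfolded arith_fun_def], of "\<lambda>i. case i of 0 \<Rightarrow> 1 | Suc 0 \<Rightarrow> 0 | Suc (Suc i) \<Rightarrow> Suc (Suc i)"]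
    by simp
  then have "arith_rel (\<lambda>F. F 0 0 = c (a (shift F)) (shift F))"
    using arith_rel_subst[of "\<lambda>m F. F 0 0 = c m (shift F)" "\<lambda>F. a (shift F)"]
      arith_fun_rename[OF assms(2)] by simp
  then show ?thesis unfolding arith_fun_def .
qed

lemma arith_fun_term:
  assumes "\<And>v F. tm_val v F s = a F"
  shows "arith_fun a"
  unfolding arith_fun_def arith_rel_def
proof (intro exI conjI allI)
  show "sat v F (Eq (App 0 Zero) (tm_inst (\<lambda>i. App (Suc i)) s)) \<longleftrightarrow> F 0 0 = a (shift F)" for v F
    by (simp add: tm_val_inst[where G = "shift F"] assms)
qed simp

lemma arith_fun_const: "arith_fun (\<lambda>F. c)"
proof (induction c)
  case 0
  show ?case by (rule arith_fun_term[of Zero]) simp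
next
  case (Suc c)
  have "arith_fun (\<lambda>F. Suc (F 0 0))"
    by (rule arith_fun_term[of "Add (App 0 Zero) One"]) simp
  from arith_fun_subst[where c = "\<lambda>m F. Suc m", OF this Suc] show ?case .
qed

lemma arith_fun_app:
  assumes "arith_fun a"
  shows "arith_fun (\<lambda>F. F i (a F))"
proof (rule arith_fun_subst[where c = "\<lambda>m F. F i m"])
  show "arith_fun (\<lambda>F. shift F i (F 0 0))"
    by (rule arith_fun_term[of "App (Suc i) (App 0 Zero)"]) simp
qed fact

lemma arith_fun_binary:
  assumes "arith_fun (\<lambda>F. f (F 1 0) (F 0 0))" "arith_fun a" "arith_fun b"
  shows "arith_fun (\<lambda>F. f (a F) (b F))"
proof (rule arith_fun_subst[OF _ assms(2), where c = "\<lambda>m F. f m (b F)"])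
  show "arith_fun (\<lambda>F. f (F 0 0) (b (shift F)))"
    using arith_fun_subst[where c = "\<lambda>m F. f (F 0 0) m" and a = "\<lambda>F. b (shift F)"]
      assms(1) arith_fun_rename[OF assms(3)] by simp
qed

lemma arith_rel_binary:
  assumes "arith_rel (\<lambda>F. R (F 1 0) (F 0 0))" "arith_fun a" "arith_fun b"
  shows "arith_rel (\<lambda>F. R (a F) (b F))"
proof (rule arith_rel_subst[OF _ assms(2), where P = "\<lambda>m F. R m (b F)"])
  show "arith_rel (\<lambda>F. R (F 0 0) (b (shift F)))"
    using arith_rel_subst[where P = "\<lambda>m F. R (F 0 0) m" and a = "\<lambda>F. b (shift F)"]
      assms(1) arith_fun_rename[OF assms(3)] by simp
qed

lemma arith_fun_add: "arith_fun (\<lambda>F. a F + b F)" if "arith_fun a" "arith_fun b"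
  by (rule arith_fun_binary[OF arith_fun_term[of "Add (App 1 Zero) (App 0 Zero)"] that]) simp

lemma arith_fun_mult: "arith_fun (\<lambda>F. a F * b F)" if "arith_fun a" "arith_fun b"
  by (rule arith_fun_binary[OF arith_fun_term[of "Mul (App 1 Zero) (App 0 Zero)"] that]) simp

lemma arith_fun_power: "arith_fun (\<lambda>F. a F ^ b F)" if "arith_fun a" "arith_fun b"
  by (rule arith_fun_binary[OF arith_fun_term[of "Exp (App 1 Zero) (App 0 Zero)"] that]) simp

lemma arith_fun_Suc: "arith_fun (\<lambda>F. Suc (a F))" if "arith_fun a"
  using arith_fun_add[OF that arith_fun_const[of 1]] by simp

lemma arith_eq: "arith_rel (\<lambda>F. a F = b F)" if "arith_fun a" "arith_fun b"
  by (rule arith_rel_binary[OF _ that], unfold arith_rel_def)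
    (rule exI[of _ "Eq (App 1 Zero) (App 0 Zero)"], simp)

lemma arith_less: "arith_rel (\<lambda>F. a F < b F)" if "arith_fun a" "arith_fun b"
  by (rule arith_rel_binary[OF _ that], unfold arith_rel_def)
    (rule exI[of _ "Less (App 1 Zero) (App 0 Zero)"], simp)

lemma arith_le: "arith_rel (\<lambda>F. a F \<le> b F)" if "arith_fun a" "arith_fun b"
  using arith_not[OF arith_less[OF that(2,1)]] by (simp add: not_less)

text \<open>
  Every rule below matches the outermost operation of its conclusion, so that backward chaining
  decides explicitly given relations. The bound variable of a quantifier becomes \<open>F 0 0\<close>, and the
  index of each function variable below it goes up by one.
\<close>
lemmas arith_intros = arith_not arith_conj arith_disj arith_imp arith_ex arith_all
  arith_eq arith_less arith_le arith_fun_const arith_fun_app arith_fun_add arith_fun_mult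
  arith_fun_power arith_fun_Suc

text \<open>
  The least element of an empty set is some fixed number, so the graph is arithmetical
  in that case as well.
\<close>
lemma arith_fun_Least:
  assumes "arith_rel (\<lambda>F. P (F 0 0) (shift F))"
  shows "arith_fun (\<lambda>F. LEAST m. P m F)"
proof -
  have eq: "k = (LEAST m. P m F) \<longleftrightarrow> P k F \<and> (\<forall>j. j < k \<longrightarrow> \<not> P j F) \<or>
      \<not> (\<exists>m. P m F) \<and> k = (LEAST m::nat. False)" for k F
  proof (cases "\<exists>m. P m F")
    case True
    then show ?thesis
      by (metis LeastI_ex not_less_Least linorder_neqE_nat)
  next
    case False
    then have "\<not> P m F" for m by blast
    then show ?thesis by simp
  qed
  have ren: "arith_rel (\<lambda>F. P (F i 0) (\<lambda>k. F (j + k)))" for i j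
    using arith_rename[OF assms, of "case_nat i (\<lambda>k. j + k)"] by simp
  have "arith_rel (\<lambda>F. P (F 0 0) (shift F))" "arith_rel (\<lambda>F. P (F 0 0) (\<lambda>k. F (Suc (Suc k))))"
    using ren[of 0 1] ren[of 0 2] by simp_all
  then show ?thesis
    unfolding arith_fun_def eq by (intro arith_intros)
qed

lemma arith_fun_minus: "arith_fun (\<lambda>F. a F - b F)" if "arith_fun a" "arith_fun b"
proof (rule arith_fun_binary[OF _ that])
  have "x - y = (LEAST d. x \<le> y + d)" for x y :: nat
    by (rule Least_equality[symmetric]) auto
  then show "arith_fun (\<lambda>F. F 1 0 - F 0 0)"
    by (auto intro!: arith_fun_Least arith_intros)
qed

lemma arith_fun_if: "arith_fun (\<lambda>F. if P F then a F else b F)"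
  if "arith_rel P" "arith_fun a" "arith_fun b"
proof -
  have eq: "(if P F then a F else b F) = (LEAST m. P F \<and> m = a F \<or> \<not> P F \<and> m = b F)" for F
    by (auto intro!: Least_equality[symmetric])
  show ?thesis
    unfolding eq
    by (rule arith_fun_Least, intro arith_intros arith_rename[OF that(1)]
        arith_fun_rename[OF that(2)] arith_fun_rename[OF that(3)])
qed

lemma arith_fun_div: "arith_fun (\<lambda>F. a F div b F)" if "arith_fun a" "arith_fun b"
proof (rule arith_fun_binary[OF _ that])
  have "x div y = (if y = 0 then 0 else LEAST q. x < Suc q * y)" for x y :: nat
  proof (cases "y = 0")
    case False
    have "(LEAST q. x < Suc q * y) = x div y"
    proof (rule Least_equality)
      show "x < Suc (x div y) * y"
        using False dividend_less_div_times[of y x] by simp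
    next
      fix q assume "x < Suc q * y"
      then have "x div y < Suc q"
        using False by (simp add: div_less_iff_less_mult)
      then show "x div y \<le> q" by simp
    qed
    then show ?thesis using False by simp
  qed simp
  then show "arith_fun (\<lambda>F. F 1 0 div F 0 0)"
    by (auto intro!: arith_fun_if arith_fun_Least arith_intros)
qed

lemma arith_fun_mod: "arith_fun (\<lambda>F. a F mod b F)" if "arith_fun a" "arith_fun b"
proof -
  have "arith_fun (\<lambda>F. a F - b F * (a F div b F))"
    by (intro arith_fun_minus arith_fun_mult arith_fun_div that)
  then show ?thesis by (simp add: minus_mult_div_eq_mod)
qed

text \<open>
  Finite sequences are coded by the digits of a number in a sufficiently large base, since
  exponentiation is a primitive of the language.
\<close>
lemma digits_ex:
  fixes f :: "nat \<Rightarrow> nat"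
  assumes "\<forall>i\<le>k. f i < B"
  shows "\<exists>s. \<forall>i\<le>k. s div B ^ i mod B = f i"
  using assms
proof (induction k arbitrary: f)
  case 0
  then show ?case by (intro exI[of _ "f 0"]) simp
next
  case (Suc k)
  then obtain s where s: "\<forall>i\<le>k. s div B ^ i mod B = f (Suc i)"
    using Suc.IH[of "\<lambda>i. f (Suc i)"] by fastforce
  have "f 0 < B" using Suc.prems by simp
  then have "(f 0 + B * s) div B ^ i mod B = f i" if "i \<le> Suc k" for i
    using that s by (cases i) (simp_all add: div_mult2_eq)
  then show ?case by blast
qed

text \<open>
  Primitive recursion is expressed by the existence of a code of the finite sequence of
  intermediate values.
\<close>
lemma arith_fun_rec:
  assumes "arith_fun a" "arith_fun (\<lambda>F. s (F 0 0) (F 1 0) (\<lambda>i. F (Suc (Suc i))))" "arith_fun n"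
  shows "arith_fun (\<lambda>F. rec_nat (a F) (\<lambda>i p. s i p F) (n F))"
proof -
  have eq: "k = rec_nat b t m \<longleftrightarrow> (\<exists>c B. c div B ^ 0 mod B = b \<and>
      (\<forall>i. i < m \<longrightarrow> c div B ^ Suc i mod B = t i (c div B ^ i mod B)) \<and> k = c div B ^ m mod B)"
    (is "_ \<longleftrightarrow> ?R") for b :: nat and t m k
  proof
    assume k: "k = rec_nat b t m"
    let ?f = "rec_nat b t"
    define B where "B = Suc (Max (?f ` {..m}))"
    have "\<forall>i\<le>m. ?f i < B" by (auto simp: B_def less_Suc_eq_le)
    then obtain c where c: "\<forall>i\<le>m. c div B ^ i mod B = ?f i"
      using digits_ex by blast
    show ?R
      by (rule exI[of _ c], rule exI[of _ B]) (use c[rule_format, of 0] c k in \<open>auto simp del: power_Suc\<close>)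
  next
    assume ?R
    then obtain c B where c: "c div B ^ 0 mod B = b" "k = c div B ^ m mod B"
      "\<And>i. i < m \<Longrightarrow> c div B ^ Suc i mod B = t i (c div B ^ i mod B)"
      by blast
    have "i \<le> m \<Longrightarrow> c div B ^ i mod B = rec_nat b t i" for i
    proof (induction i)
      case 0
      then show ?case using c(1) by simp
    next
      case (Suc i)
      then show ?case using c(3)[of i] by simp
    qed
    then show "k = rec_nat b t m" using c(2) by simp
  qed
  have "arith_fun (\<lambda>F. s (F 1 0) (F 0 0) (\<lambda>i. F (5 + i)))"
    using arith_fun_rename[OF assms(2), of "\<lambda>i. case i of 0 \<Rightarrow> 1 | Suc 0 \<Rightarrow> 0 | Suc (Suc i) \<Rightarrow> 5 + i"]
    by simp
  then have s: "arith_fun (\<lambda>F. s (F 0 0) (F 2 0 div F 1 0 ^ F 0 0 mod F 1 0) (\<lambda>i. F (4 + i)))"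
    using arith_fun_subst[where c = "\<lambda>m F. s (F 0 0) m (\<lambda>i. F (4 + i))" and a = "\<lambda>F. F 2 0 div F 1 0 ^ F 0 0 mod F 1 0"]
    by (simp add: arith_fun_mod arith_fun_div arith_intros)
  have a: "arith_fun (\<lambda>F. a (\<lambda>i. F (3 + i)))" "arith_fun (\<lambda>F. n (\<lambda>i. F (3 + i)))"
    "arith_fun (\<lambda>F. n (\<lambda>i. F (4 + i)))"
    using assms by (auto intro: arith_fun_rename)
  show ?thesis
    unfolding arith_fun_def eq using s a
    by (intro arith_intros arith_fun_mod arith_fun_div) (simp_all add: numeral_eq_Suc)
qed

lemma arith_fun_tm_val:
  assumes "\<And>i. arith_fun (\<lambda>F. n F i)" "\<And>i. arith_fun (\<lambda>F. G (shift F) i (F 0 0))"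
  shows "arith_fun (\<lambda>F. tm_val (n F) (G F) t)"
proof (induction t)
  case (App i t)
  have "arith_fun (\<lambda>F. G F i (tm_val (n F) (G F) t))"
    by (rule arith_fun_subst[where c = "\<lambda>m F. G F i m", OF assms(2) App])
  then show ?case by simp
qed (simp_all add: assms arith_intros)

text \<open>
  Function variables may be replaced by arithmetical functionals. The induction needs the values of the
  number variables to be functionals as well, since a quantifier makes one of them a parameter.
\<close>
lemma arith_rel_sat:
  assumes "arithmetical \<phi>"
    and "\<And>i. arith_fun (\<lambda>F. n F i)" "\<And>i. arith_fun (\<lambda>F. G (shift F) i (F 0 0))"
  shows "arith_rel (\<lambda>F. sat (n F) (G F) \<phi>)"
  using assms
proof (induction \<phi> arbitrary: n G)
  case (Eq s t)
  show ?case
    unfolding sat.simps by (intro arith_eq arith_fun_tm_val Eq.prems)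
next
  case (Less s t)
  show ?case
    unfolding sat.simps by (intro arith_less arith_fun_tm_val Less.prems)
next
  case (Neg \<phi>)
  have "arith_rel (\<lambda>F. sat (n F) (G F) \<phi>)"
    using Neg.prems by (intro Neg.IH) simp_all
  then show ?case by (simp add: arith_not)
next
  case (Conj \<phi> \<psi>)
  have "arith_rel (\<lambda>F. sat (n F) (G F) \<phi>)" "arith_rel (\<lambda>F. sat (n F) (G F) \<psi>)"
    using Conj.prems by (intro Conj.IH; simp)+
  then show ?case by (simp add: arith_conj)
next
  case (ExN i \<phi>)
  have "arith_rel (\<lambda>F. sat ((n (shift F))(i := F 0 0)) (G (shift F)) \<phi>)"
  proof (rule ExN.IH)
    show "arith_fun (\<lambda>F. ((n (shift F))(i := F 0 0)) k)" for k
      using arith_fun_rename[OF ExN.prems(2), of Suc] by (cases "k = i") (simp_all add: arith_intros)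
    show "arith_fun (\<lambda>F. G (shift (shift F)) k (F 0 0))" for k
      using arith_fun_rename[OF ExN.prems(3), of "case_nat 0 (\<lambda>i. Suc (Suc i))" k] by simp
  qed (use ExN.prems in simp)
  then show ?case by (simp add: arith_ex[where P = "\<lambda>m F. sat ((n F)(i := m)) (G F) \<phi>"])
next
  case (AllN i \<phi>)
  have "arith_rel (\<lambda>F. sat ((n (shift F))(i := F 0 0)) (G (shift F)) \<phi>)"
  proof (rule AllN.IH)
    show "arith_fun (\<lambda>F. ((n (shift F))(i := F 0 0)) k)" for k
      using arith_fun_rename[OF AllN.prems(2), of Suc] by (cases "k = i") (simp_all add: arith_intros)
    show "arith_fun (\<lambda>F. G (shift (shift F)) k (F 0 0))" for k
      using arith_fun_rename[OF AllN.prems(3), of "case_nat 0 (\<lambda>i. Suc (Suc i))" k] by simp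
  qed (use AllN.prems in simp)
  then show ?case by (simp add: arith_all[where P = "\<lambda>m F. sat ((n F)(i := m)) (G F) \<phi>"])
qed simp_all

lemma arith_rel_comp:
  assumes "arith_rel P" "\<And>i. arith_fun (\<lambda>F. G (shift F) i (F 0 0))"
  shows "arith_rel (\<lambda>F. P (G F))"
proof -
  obtain \<phi> where \<phi>: "arithmetical \<phi>" "\<And>v F. sat v F \<phi> \<longleftrightarrow> P F"
    using assms(1) unfolding arith_rel_def by auto
  show ?thesis
    using arith_rel_sat[OF \<phi>(1), of "\<lambda>F i. 0" G] assms(2) by (simp add: \<phi>(2) arith_intros)
qed

section \<open>Projective relations\<close>

text \<open>
  Uniformly arithmetical transformations of the environment: each new function is computed from the
  old environment and its argument.
\<close>
definition arith_map :: "(fenv \<Rightarrow> fenv) \<Rightarrow> bool" where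
  "arith_map G \<longleftrightarrow> (\<forall>i. arith_fun (\<lambda>F. G (shift F) i (F 0 0)))"

lemma arith_map_case_nat:
  assumes "arith_fun (\<lambda>F. g (shift F) (F 0 0))" "arith_map G"
  shows "arith_map (\<lambda>F. case_nat (g F) (G F))"
  unfolding arith_map_def
proof
  fix i
  show "arith_fun (\<lambda>F. case_nat (g (shift F)) (G (shift F)) i (F 0 0))"
    using assms unfolding arith_map_def by (cases i) simp_all
qed

lemma arith_map_rename: "arith_map (\<lambda>F i. F (\<rho> i))"
  unfolding arith_map_def by (intro allI arith_intros)

lemma arith_map_shift:
  assumes "arith_map G"
  shows "arith_map (\<lambda>F. G (shift F))"
  unfolding arith_map_def
proof
  fix i
  show "arith_fun (\<lambda>F. G (\<lambda>i. F (Suc (Suc i))) i (F 0 0))"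
    using arith_fun_rename[OF assms[unfolded arith_map_def, rule_format, of i],
        of "case_nat 0 (\<lambda>i. Suc (Suc i))"] by simp
qed

text \<open>
  \<open>pi_rel n\<close> is the class \<open>\<Pi>\<^sup>1\<^sub>n\<close> of relations on function environments. The quantified function becomes
  the new variable \<open>0\<close>, as with de Bruijn indices, so substitutions cannot capture variables.
  The class \<open>\<Sigma>\<^sup>1\<^sub>n\<close> is represented by the negations.
\<close>
primrec pi_rel :: "nat \<Rightarrow> (fenv \<Rightarrow> bool) \<Rightarrow> bool" where
  "pi_rel 0 P \<longleftrightarrow> arith_rel P"
| "pi_rel (Suc n) P \<longleftrightarrow> (\<exists>Q. pi_rel n Q \<and> (\<forall>F. P F \<longleftrightarrow> (\<forall>f. \<not> Q (case_nat f F))))"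

text \<open>
  The conclusion is phrased with \<open>\<circ>\<close> instead of an abstraction so that instantiating the induction
  hypothesis is a first-order unification problem.
\<close>
lemma pi_rel_comp:
  assumes "pi_rel n P" "arith_map G"
  shows "pi_rel n (P \<circ> G)"
  using assms
proof (induction n arbitrary: P G)
  case 0
  then show ?case using arith_rel_comp[of P G] by (simp add: arith_map_def comp_def)
next
  case (Suc n)
  obtain Q where Q: "pi_rel n Q" "\<And>F. P F \<longleftrightarrow> (\<forall>f. \<not> Q (case_nat f F))"
    using Suc.prems(1) by auto
  define H where "H F = case_nat (F 0) (G (shift F))" for F
  have "arith_map H"
    unfolding H_def
    by (rule arith_map_case_nat[OF _ arith_map_shift[OF Suc.prems(2)]]) (intro arith_intros)
  then have "pi_rel n (Q \<circ> H)" by (rule Suc.IH[OF Q(1)])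
  moreover have "(P \<circ> G) F \<longleftrightarrow> (\<forall>f. \<not> (Q \<circ> H) (case_nat f F))" for F
    by (simp add: Q(2) H_def)
  ultimately show ?case
    unfolding pi_rel.simps by blast
qed

lemma pi_rel_rename:
  assumes "pi_rel n P"
  shows "pi_rel n (\<lambda>F. P (\<lambda>i. F (\<rho> i)))"
  using pi_rel_comp[OF assms arith_map_rename] by (simp add: comp_def)

text \<open>
  A universal number quantifier in front of a universal function quantifier is absorbed by it:
  the pair \<open>(a, f)\<close> is the function with value \<open>a\<close> at \<open>0\<close> followed by \<open>f\<close>. No choice is
  involved, and the quantifiers further inside are left alone. At level \<open>0\<close> the quantifier is
  itself arithmetical.
\<close>
lemma pi_rel_all_number:
  assumes "pi_rel n P"
  shows "pi_rel n (\<lambda>F. \<forall>a. P (case_nat (\<lambda>_. a) F))"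
proof (cases n)
  case 0
  have "arith_map (\<lambda>F. case_nat (\<lambda>_. F 0 0) (shift F))"
    by (rule arith_map_case_nat[OF _ arith_map_rename]) (intro arith_intros)
  then have "arith_rel (\<lambda>F. P (case_nat (\<lambda>_. F 0 0) (shift F)))"
    using pi_rel_comp[of 0 P] assms 0 by (simp add: comp_def)
  then show ?thesis
    unfolding 0 pi_rel.simps by (rule arith_all[where P = "\<lambda>m F. P (case_nat (\<lambda>_. m) F)"])
next
  case (Suc n')
  obtain Q where Q: "pi_rel n' Q" "\<And>F. P F \<longleftrightarrow> (\<forall>f. \<not> Q (case_nat f F))"
    using assms Suc by auto
  define G :: "fenv \<Rightarrow> fenv"
    where "G F = case_nat (\<lambda>t. F 0 (Suc t)) (case_nat (\<lambda>_. F 0 0) (shift F))" for F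
  have "arith_map G"
    unfolding G_def by (rule arith_map_case_nat[OF _ arith_map_case_nat[OF _ arith_map_rename]])
      (intro arith_intros)+
  then have "pi_rel n' (Q \<circ> G)" by (rule pi_rel_comp[OF Q(1)])
  moreover have "(\<forall>a. P (case_nat (\<lambda>_. a) F)) \<longleftrightarrow> (\<forall>g. \<not> (Q \<circ> G) (case_nat g F))" for F
  proof
    assume "\<forall>a. P (case_nat (\<lambda>_. a) F)"
    then show "\<forall>g. \<not> (Q \<circ> G) (case_nat g F)" by (simp add: Q(2) G_def)
  next
    assume *: "\<forall>g. \<not> (Q \<circ> G) (case_nat g F)"
    have "\<not> Q (case_nat f (case_nat (\<lambda>_. a) F))" for a f
      using *[rule_format, of "case_nat a f"] by (simp add: G_def)
    then show "\<forall>a. P (case_nat (\<lambda>_. a) F)" by (simp add: Q(2))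
  qed
  ultimately show ?thesis
    unfolding Suc pi_rel.simps by blast
qed

text \<open>
  Each quantifier negates the rest of the prefix, so conjunctions and disjunctions are treated
  together.
\<close>
lemma pi_rel_conj_disj_arith:
  assumes "pi_rel n P" "arith_rel A"
  shows "pi_rel n (\<lambda>F. P F \<and> A F) \<and> pi_rel n (\<lambda>F. P F \<or> A F)"
  using assms
proof (induction n arbitrary: P A)
  case 0
  then show ?case by (simp add: arith_conj arith_disj)
next
  case (Suc n)
  obtain Q where Q: "pi_rel n Q" "\<And>F. P F \<longleftrightarrow> (\<forall>f. \<not> Q (case_nat f F))"
    using Suc.prems(1) by auto
  define B where "B F \<longleftrightarrow> \<not> A (shift F)" for F
  have B: "arith_rel B"
    unfolding B_def by (rule arith_not[OF arith_rename[OF Suc.prems(2)]])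
  have BA: "B (case_nat f F) \<longleftrightarrow> \<not> A F" for f F by (simp add: B_def)
  have QB: "pi_rel n (\<lambda>F. Q F \<and> B F)" "pi_rel n (\<lambda>F. Q F \<or> B F)"
    using Suc.IH[OF Q(1) B] by auto
  have conj: "P F \<and> A F \<longleftrightarrow> (\<forall>f. \<not> (Q (case_nat f F) \<or> B (case_nat f F)))" for F
    by (simp add: Q(2) BA)
  have disj: "P F \<or> A F \<longleftrightarrow> (\<forall>f. \<not> (Q (case_nat f F) \<and> B (case_nat f F)))" for F
    by (auto simp: Q(2) BA)
  show ?case
    unfolding pi_rel.simps using QB conj disj by blast
qed

lemmas pi_rel_conj_arith = pi_rel_conj_disj_arith[THEN conjunct1]

text \<open>
  A quantifier over a named variable is a de Bruijn quantifier after a renaming.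
\<close>
lemma case_nat_rename: "F(i := f) = (\<lambda>k. case_nat f F (if k = i then 0 else Suc k))"
  by auto

lemma pi_rel_of_fm:
  "Sigma1_fm n \<phi> \<Longrightarrow> pi_rel n (\<lambda>F. \<not> sat v F \<phi>)"
  "Pi1_fm n \<phi> \<Longrightarrow> pi_rel n (\<lambda>F. sat v F \<phi>)"
proof (induction n \<phi> and n \<phi> rule: Sigma1_fm_Pi1_fm.inducts)
  case (1 \<phi>)
  have "arith_rel (\<lambda>F. sat v F \<phi>)"
    by (rule arith_rel_sat[OF 1]) (simp_all add: arith_intros)
  then show ?case by (simp add: arith_not)
next
  case (2 \<phi>)
  have "arith_rel (\<lambda>F. sat v F \<phi>)"
    by (rule arith_rel_sat[OF 2]) (simp_all add: arith_intros)
  then show ?case by simp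
next
  case (3 n \<phi> i)
  let ?Q = "\<lambda>F. sat v (\<lambda>k. F (if k = i then 0 else Suc k)) \<phi>"
  have "pi_rel n ?Q"
    using pi_rel_rename[OF 3(2)] by simp
  then show ?case
    unfolding pi_rel.simps by (intro exI[of _ ?Q]) (simp add: case_nat_rename[symmetric])
next
  case (4 n \<phi> i)
  let ?Q = "\<lambda>F. \<not> sat v (\<lambda>k. F (if k = i then 0 else Suc k)) \<phi>"
  have "pi_rel n ?Q"
    using pi_rel_rename[OF 4(2)] by simp
  then show ?case
    unfolding pi_rel.simps by (intro exI[of _ ?Q]) (simp add: case_nat_rename[symmetric])
qed

section \<open>Projective relations and formulas with named variables\<close>

text \<open>
  To return from de Bruijn indices to named variables, the quantified function needs a name that occurs
  nowhere else. It exists because a definable relation depends only on finitely many variables.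
\<close>
definition depends_below :: "nat \<Rightarrow> (fenv \<Rightarrow> 'a) \<Rightarrow> bool" where
  "depends_below N P \<longleftrightarrow> (\<forall>F G. (\<forall>i<N. F i = G i) \<longrightarrow> P F = P G)"

lemma eventually_depends_tm: "\<forall>\<^sub>F N in sequentially. \<forall>v. depends_below N (\<lambda>F. tm_val v F t)"
proof (induction t)
  case (App i t)
  with eventually_gt_at_top[of i] show ?case
    by eventually_elim (simp add: depends_below_def, metis)
next
  case (Add s t)
  then show ?case by eventually_elim (simp add: depends_below_def, metis)
next
  case (Mul s t)
  then show ?case by eventually_elim (simp add: depends_below_def, metis)
next
  case (Exp s t)
  then show ?case by eventually_elim (simp add: depends_below_def, metis)
qed (simp_all add: depends_below_def)

lemma eventually_depends_arith:
  assumes "arithmetical \<phi>"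
  shows "\<forall>\<^sub>F N in sequentially. \<forall>v. depends_below N (\<lambda>F. sat v F \<phi>)"
  using assms
proof (induction \<phi>)
  case (Eq s t)
  from eventually_depends_tm[of s] eventually_depends_tm[of t]
  show ?case by eventually_elim (simp add: depends_below_def, metis)
next
  case (Less s t)
  from eventually_depends_tm[of s] eventually_depends_tm[of t]
  show ?case by eventually_elim (simp add: depends_below_def, metis)
next
  case (Neg \<phi>)
  then show ?case by (simp add: depends_below_def)
next
  case (Conj \<phi> \<psi>)
  then have "\<forall>\<^sub>F N in sequentially. \<forall>v. depends_below N (\<lambda>F. sat v F \<phi>)"
    "\<forall>\<^sub>F N in sequentially. \<forall>v. depends_below N (\<lambda>F. sat v F \<psi>)"
    by simp_all
  then show ?case by eventually_elim (simp add: depends_below_def, metis)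
next
  case (ExN i \<phi>)
  then have "\<forall>\<^sub>F N in sequentially. \<forall>v. depends_below N (\<lambda>F. sat v F \<phi>)" by simp
  then show ?case by eventually_elim (simp add: depends_below_def, metis)
next
  case (AllN i \<phi>)
  then have "\<forall>\<^sub>F N in sequentially. \<forall>v. depends_below N (\<lambda>F. sat v F \<phi>)" by simp
  then show ?case by eventually_elim (simp add: depends_below_def, metis)
qed simp_all

lemma ex_depends_below:
  assumes "pi_rel n P"
  shows "\<exists>N. depends_below N P"
  using assms
proof (induction n arbitrary: P)
  case 0
  then obtain \<phi> where \<phi>: "arithmetical \<phi>" "\<And>v F. sat v F \<phi> \<longleftrightarrow> P F"
    unfolding pi_rel.simps arith_rel_def by auto
  obtain N where "\<forall>v. depends_below N (\<lambda>F. sat v F \<phi>)"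
    using eventually_depends_arith[OF \<phi>(1)] unfolding eventually_sequentially by blast
  then show ?case by (auto simp: \<phi>(2))
next
  case (Suc n)
  then obtain Q where Q: "pi_rel n Q" "\<And>F. P F \<longleftrightarrow> (\<forall>f. \<not> Q (case_nat f F))"
    by auto
  from Suc.IH[OF Q(1)] obtain N where N: "depends_below N Q" ..
  have "P F = P G" if "\<forall>i<N. F i = G i" for F G
  proof -
    have "Q (case_nat f F) = Q (case_nat f G)" for f
      using N that unfolding depends_below_def
      by (elim allE[of _ "case_nat f F"] allE[of _ "case_nat f G"]) (auto split: nat.split)
    then show ?thesis by (simp add: Q(2))
  qed
  then show ?case unfolding depends_below_def by blast
qed

lemma fm_of_pi_rel:
  assumes "pi_rel n P"
  shows "(\<exists>\<phi>. Pi1_fm n \<phi> \<and> (\<forall>v F. sat v F \<phi> \<longleftrightarrow> P F)) \<and>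
    (\<exists>\<phi>. Sigma1_fm n \<phi> \<and> (\<forall>v F. sat v F \<phi> \<longleftrightarrow> \<not> P F))"
  using assms
proof (induction n arbitrary: P)
  case 0
  then obtain \<phi> where \<phi>: "arithmetical \<phi>" "\<And>v F. sat v F \<phi> \<longleftrightarrow> P F"
    unfolding pi_rel.simps arith_rel_def by auto
  have "Pi1_fm 0 \<phi>" "Sigma1_fm 0 (Neg \<phi>)"
    using \<phi>(1) by (simp_all add: Sigma1_fm_Pi1_fm.intros)
  moreover have "\<And>v F. sat v F (Neg \<phi>) \<longleftrightarrow> \<not> P F"
    by (simp add: \<phi>(2))
  ultimately show ?case using \<phi>(2) by blast
next
  case (Suc n)
  obtain Q where Q: "pi_rel n Q" "\<And>F. P F \<longleftrightarrow> (\<forall>f. \<not> Q (case_nat f F))"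
    using Suc.prems by auto
  obtain N where N: "depends_below N Q" using ex_depends_below[OF Q(1)] ..
  define R where "R F = Q (\<lambda>i. F (case_nat N id i))" for F
  have R: "pi_rel n R" unfolding R_def by (rule pi_rel_rename[OF Q(1)])
  have RQ: "R (F(N := f)) = Q (case_nat f F)" for F f
    using N unfolding depends_below_def R_def
    by (elim allE[of _ "\<lambda>i. (F(N := f)) (case_nat N id i)"] allE[of _ "case_nat f F"])
      (auto split: nat.split)
  obtain \<phi> \<psi> where \<phi>: "Sigma1_fm n \<phi>" "\<And>v F. sat v F \<phi> \<longleftrightarrow> \<not> R F"
    and \<psi>: "Pi1_fm n \<psi>" "\<And>v F. sat v F \<psi> \<longleftrightarrow> R F"
    using Suc.IH[OF R] by blast
  have "Pi1_fm (Suc n) (AllF N \<phi>)" "Sigma1_fm (Suc n) (ExF N \<psi>)"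
    using \<phi>(1) \<psi>(1) by (simp_all add: Sigma1_fm_Pi1_fm.intros)
  moreover have "\<And>v F. sat v F (AllF N \<phi>) \<longleftrightarrow> P F" "\<And>v F. sat v F (ExF N \<psi>) \<longleftrightarrow> \<not> P F"
    by (simp_all add: \<phi>(2) \<psi>(2) RQ Q(2))
  ultimately show ?case by blast
qed

text \<open>
  With this lemma and the next one, formulas disappear from the argument. All variables other than
  \<open>x\<close> are identified with the parameter \<open>r\<close>, so that a definition cannot depend on them.
\<close>
lemma Pi1_iff:
  "A \<in> Pi1 n r \<longleftrightarrow> (\<exists>P. pi_rel n P \<and> (\<forall>x. x \<in> A \<longleftrightarrow> P (case_nat (indicator x) (\<lambda>_. indicator r))))"
proof
  assume "A \<in> Pi1 n r"
  then obtain \<phi> where "Pi1_fm n \<phi>" "defining_fm \<phi> r A"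
    unfolding Pi1_def by blast
  then show "\<exists>P. pi_rel n P \<and> (\<forall>x. x \<in> A \<longleftrightarrow> P (case_nat (indicator x) (\<lambda>_. indicator r)))"
    by (intro exI[of _ "\<lambda>F. sat (\<lambda>_. 0) F \<phi>"] conjI pi_rel_of_fm) (simp_all add: defining_fm_def)
next
  assume "\<exists>P. pi_rel n P \<and> (\<forall>x. x \<in> A \<longleftrightarrow> P (case_nat (indicator x) (\<lambda>_. indicator r)))"
  then obtain P where P: "pi_rel n P" "\<And>x. x \<in> A \<longleftrightarrow> P (case_nat (indicator x) (\<lambda>_. indicator r))"
    by blast
  obtain \<phi> where \<phi>: "Pi1_fm n \<phi>" "\<And>v F. sat v F \<phi> \<longleftrightarrow> P (\<lambda>i. F (case_nat 0 (\<lambda>_. 1) i))"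
    using fm_of_pi_rel[OF pi_rel_rename[OF P(1), of "case_nat 0 (\<lambda>_. 1)"]] by blast
  have "(\<lambda>i. F (case_nat 0 (\<lambda>_. 1) i)) = case_nat (F 0) (\<lambda>_. F 1)" for F :: fenv
    by (auto split: nat.split)
  then have "defining_fm \<phi> r A"
    unfolding defining_fm_def \<phi>(2) P(2) by auto
  with \<phi>(1) show "A \<in> Pi1 n r" unfolding Pi1_def by blast
qed

lemma Sigma1_iff:
  "A \<in> Sigma1 n r \<longleftrightarrow> - A \<in> Pi1 n r"
proof
  assume "A \<in> Sigma1 n r"
  then obtain \<phi> where "Sigma1_fm n \<phi>" "defining_fm \<phi> r A"
    unfolding Sigma1_def by blast
  then show "- A \<in> Pi1 n r"
    unfolding Pi1_iff
    by (intro exI[of _ "\<lambda>F. \<not> sat (\<lambda>_. 0) F \<phi>"] conjI pi_rel_of_fm) (simp_all add: defining_fm_def)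
next
  assume "- A \<in> Pi1 n r"
  then obtain \<phi> where \<phi>: "Pi1_fm n \<phi>" "defining_fm \<phi> r (- A)"
    unfolding Pi1_def by blast
  obtain \<psi> where \<psi>: "Sigma1_fm n \<psi>" "\<And>v F. sat v F \<psi> \<longleftrightarrow> \<not> sat (\<lambda>_. 0) F \<phi>"
    using fm_of_pi_rel[OF pi_rel_of_fm(2)[OF \<phi>(1), of "\<lambda>_. 0"]] by blast
  have "defining_fm \<psi> r A"
    using \<phi>(2) unfolding defining_fm_def \<psi>(2) by blast
  with \<psi>(1) show "A \<in> Sigma1 n r" unfolding Sigma1_def by blast
qed

section \<open>Ultrafilters and their Fubini squares\<close>

lemma omega_filter_iff:
  "omega_filter U \<longleftrightarrow> (\<forall>x\<in>U. \<forall>y\<in>U. x \<inter> y \<in> U) \<and> (\<forall>x\<in>U. \<forall>y. x \<subseteq> y \<longrightarrow> y \<in> U) \<and>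
     (\<forall>x. finite (- x) \<longrightarrow> x \<in> U) \<and> {} \<notin> U" (is "_ \<longleftrightarrow> ?R")
proof
  assume U: "omega_filter U"
  then interpret is_filter "\<lambda>P. Collect P \<in> U" by (simp add: omega_filter_def)
  have "x \<inter> y \<in> U" if "x \<in> U" "y \<in> U" for x y
    using conj[of "\<lambda>n. n \<in> x" "\<lambda>n. n \<in> y"] that by (simp add: Int_def)
  moreover have "y \<in> U" if "x \<in> U" "x \<subseteq> y" for x y
    using mono[of "\<lambda>n. n \<in> x" "\<lambda>n. n \<in> y"] that by auto
  ultimately show ?R using U unfolding omega_filter_def by blast
next
  assume R: ?R
  then have "UNIV \<in> U" by simp
  moreover have "{n. P n \<and> Q n} \<in> U" if "Collect P \<in> U" "Collect Q \<in> U" for P Q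
    using R that by (metis Collect_conj_eq)
  moreover have "Collect Q \<in> U" if "\<forall>n. P n \<longrightarrow> Q n" "Collect P \<in> U" for P Q
    using R that by (metis Collect_mono)
  ultimately have "is_filter (\<lambda>P. Collect P \<in> U)"
    by unfold_locales auto
  then show "omega_filter U" using R unfolding omega_filter_def by blast
qed

text \<open>
  If neither \<open>x\<close> nor its complement were in a maximal filter, adjoining the complement of \<open>x\<close> would
  yield a larger one.
\<close>
lemma omega_ultrafilter_iff:
  "omega_ultrafilter U \<longleftrightarrow> omega_filter U \<and> (\<forall>x. x \<in> U \<or> - x \<in> U)"
proof
  assume U: "omega_ultrafilter U"
  then have fU: "omega_filter U" unfolding omega_ultrafilter_def by blast
  have "- x \<in> U" if "x \<notin> U" for x
  proof -
    define V where "V = {y. \<exists>u\<in>U. u - x \<subseteq> y}"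
    have UV: "U \<subseteq> V" unfolding V_def by blast
    have "omega_filter V"
      unfolding omega_filter_iff
    proof (intro conjI ballI allI impI)
      fix y z assume "y \<in> V" "z \<in> V"
      then obtain u w where uw: "u \<in> U" "w \<in> U" "u - x \<subseteq> y" "w - x \<subseteq> z"
        unfolding V_def by blast
      then have "u \<inter> w \<in> U" using fU unfolding omega_filter_iff by blast
      moreover have "u \<inter> w - x \<subseteq> y \<inter> z" using uw by blast
      ultimately show "y \<inter> z \<in> V" unfolding V_def by blast
    next
      fix y z assume "y \<in> V" "y \<subseteq> z"
      then show "z \<in> V" unfolding V_def by blast
    next
      fix y :: "nat set" assume "finite (- y)"
      then have "y \<in> U" using fU unfolding omega_filter_iff by blast
      then show "y \<in> V" using UV by blast
    next
      have "\<not> u - x \<subseteq> {}" if "u \<in> U" for u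
        using that \<open>x \<notin> U\<close> fU unfolding omega_filter_iff by blast
      then show "{} \<notin> V" unfolding V_def by blast
    qed
    with U UV have "V = U" unfolding omega_ultrafilter_def by blast
    moreover have "UNIV \<in> U" using fU unfolding omega_filter_iff by simp
    then have "- x \<in> V" unfolding V_def by blast
    ultimately show "- x \<in> U" by simp
  qed
  with fU show "omega_filter U \<and> (\<forall>x. x \<in> U \<or> - x \<in> U)" by blast
next
  assume U: "omega_filter U \<and> (\<forall>x. x \<in> U \<or> - x \<in> U)"
  have "V = U" if V: "omega_filter V" "U \<subseteq> V" for V
  proof -
    have "x \<in> U" if "x \<in> V" for x
    proof (rule ccontr)
      assume "x \<notin> U"
      then have "- x \<in> V" using U V(2) by blast
      then have "x \<inter> - x \<in> V" using that V(1) unfolding omega_filter_iff by blast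
      then show False using V(1) unfolding omega_filter_iff by simp
    qed
    then show ?thesis using V(2) by blast
  qed
  then show "omega_ultrafilter U" using U unfolding omega_ultrafilter_def by blast
qed

context
  fixes U :: "nat set set"
  assumes U: "omega_ultrafilter U"
begin

lemma ultrafilter_Int: "x \<in> U \<Longrightarrow> y \<in> U \<Longrightarrow> x \<inter> y \<in> U"
  using U unfolding omega_ultrafilter_iff omega_filter_iff by blast

lemma ultrafilter_mono: "x \<in> U \<Longrightarrow> x \<subseteq> y \<Longrightarrow> y \<in> U"
  using U unfolding omega_ultrafilter_iff omega_filter_iff by blast

lemma ultrafilter_cofinite: "finite (- x) \<Longrightarrow> x \<in> U"
  using U unfolding omega_ultrafilter_iff omega_filter_iff by blast

lemma ultrafilter_empty: "{} \<notin> U"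
  using U unfolding omega_ultrafilter_iff omega_filter_iff by blast

lemma ultrafilter_Compl: "- x \<in> U \<longleftrightarrow> x \<notin> U"
  using U ultrafilter_Int[of x "- x"] ultrafilter_empty unfolding omega_ultrafilter_iff by auto

lemma ultrafilter_infinite: "x \<in> U \<Longrightarrow> infinite x"
  using ultrafilter_cofinite[of "- x"] ultrafilter_Compl[of x] by auto

lemma ultrafilter_almost_mono:
  assumes "x \<in> U" "finite (x - y)"
  shows "y \<in> U"
proof -
  have "- (x - y) \<in> U"
    using assms(2) by (intro ultrafilter_cofinite) (simp only: double_complement)
  with assms(1) have "x \<inter> - (x - y) \<in> U" by (rule ultrafilter_Int)
  then show ?thesis by (rule ultrafilter_mono) blast
qed

end

definition column :: "nat set \<Rightarrow> nat \<Rightarrow> nat set" where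
  "column x a = {b. prod_encode (a, b) \<in> x}"

lemma column_Compl: "column (- x) a = - column x a"
  by (auto simp: column_def)

definition fubini_square :: "nat set set \<Rightarrow> nat set set" where
  "fubini_square U = {x. {a. column x a \<in> U} \<in> U}"

lemma omega_ultrafilter_fubini_square:
  assumes U: "omega_ultrafilter U"
  shows "omega_ultrafilter (fubini_square U)"
  unfolding omega_ultrafilter_iff omega_filter_iff
proof (intro conjI ballI allI impI)
  fix x y assume "x \<in> fubini_square U" "y \<in> fubini_square U"
  then have "{a. column x a \<in> U} \<inter> {a. column y a \<in> U} \<in> U"
    unfolding fubini_square_def using ultrafilter_Int[OF U] by blast
  moreover have "column x a \<inter> column y a = column (x \<inter> y) a" for a
    by (auto simp: column_def)
  then have "{a. column x a \<in> U} \<inter> {a. column y a \<in> U} \<subseteq> {a. column (x \<inter> y) a \<in> U}"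
    using ultrafilter_Int[OF U] by (metis (no_types, lifting) IntE mem_Collect_eq subsetI)
  ultimately show "x \<inter> y \<in> fubini_square U"
    unfolding fubini_square_def using ultrafilter_mono[OF U] by blast
next
  fix x y assume x: "x \<in> fubini_square U" "x \<subseteq> y"
  then have "column x a \<subseteq> column y a" for a by (auto simp: column_def)
  then have "{a. column x a \<in> U} \<subseteq> {a. column y a \<in> U}"
    using ultrafilter_mono[OF U] by blast
  then show "y \<in> fubini_square U"
    using x(1) unfolding fubini_square_def using ultrafilter_mono[OF U] by blast
next
  fix x :: "nat set" assume x: "finite (- x)"
  have "column x a \<in> U" for a
  proof (rule ultrafilter_cofinite[OF U])
    have "- column x a = (\<lambda>b. prod_encode (a, b)) -` (- x)"
      by (auto simp: column_def)
    moreover have "inj (\<lambda>b. prod_encode (a, b))" by (auto intro: injI)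
    ultimately show "finite (- column x a)"
      using x by (simp add: finite_vimageI)
  qed
  then show "x \<in> fubini_square U"
    unfolding fubini_square_def by (simp add: ultrafilter_cofinite[OF U])
next
  show "{} \<notin> fubini_square U"
    by (simp add: fubini_square_def column_def ultrafilter_empty[OF U])
next
  fix x
  have "- {a. column x a \<in> U} = {a. column (- x) a \<in> U}"
    by (auto simp: column_Compl ultrafilter_Compl[OF U])
  then show "x \<in> fubini_square U \<or> - x \<in> fubini_square U"
    unfolding fubini_square_def using ultrafilter_Compl[OF U, of "{a. column x a \<in> U}"] by auto
qed

section \<open>Coding a function into a set by deleting finitely many points per column\<close>

text \<open>
  The increasing enumeration of a set, given by a plain recursion on values (instead of on the
  remaining set), which makes it visibly arithmetical in the set.
\<close>
definition nth_elt :: "nat set \<Rightarrow> nat \<Rightarrow> nat" where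
  "nth_elt S k = rec_nat (LEAST b. b \<in> S) (\<lambda>_ p. LEAST b. b \<in> S \<and> p < b) k"

lemma nth_elt_simps:
  "nth_elt S 0 = (LEAST b. b \<in> S)"
  "nth_elt S (Suc k) = (LEAST b. b \<in> S \<and> nth_elt S k < b)"
  by (simp_all add: nth_elt_def)

lemma nth_elt_eq_enumerate:
  assumes "infinite S"
  shows "nth_elt S k = enumerate S k"
  by (induction k) (use assms in \<open>simp_all add: nth_elt_simps enumerate_0 enumerate_Suc''\<close>)

lemma nth_elt_segment:
  assumes e: "strict_mono (e :: nat \<Rightarrow> nat)"
    and c: "\<And>b. b \<in> c \<Longrightarrow> \<exists>i\<ge>s. b = e i" "\<And>i. s \<le> i \<Longrightarrow> i \<le> s + h \<Longrightarrow> e i \<in> c"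
    and "j \<le> h"
  shows "nth_elt c j = e (s + j)"
  using \<open>j \<le> h\<close>
proof (induction j)
  case 0
  show ?case
    unfolding nth_elt_simps
  proof (rule Least_equality)
    show "e (s + 0) \<in> c" by (rule c) auto
    show "e (s + 0) \<le> b" if "b \<in> c" for b
      using c(1)[OF that] strict_mono_less_eq[OF e] by auto
  qed
next
  case (Suc j)
  then have IH: "nth_elt c j = e (s + j)" by simp
  show ?case
    unfolding nth_elt_simps IH
  proof (rule Least_equality)
    show "e (s + Suc j) \<in> c \<and> e (s + j) < e (s + Suc j)"
      using Suc.prems c(2) strict_mono_less[OF e] by auto
    show "e (s + Suc j) \<le> b" if "b \<in> c \<and> e (s + j) < b" for b
      using c(1)[of b] that strict_mono_less[OF e] strict_mono_less_eq[OF e] by auto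
  qed
qed

text \<open>
  Suppose that \<open>x\<close> has infinitely many nonempty columns, with indices \<open>a\<^sub>0 < a\<^sub>1 < \<dots>\<close>, and that they are
  infinite with increasing least points. Then the number coded at place \<open>k\<close> is the number of points of
  column \<open>a\<^sub>k\<close> below the least point of column \<open>a\<^sub>k\<^sub>+\<^sub>1\<close>, minus one. The shift by one leaves the least
  point of column \<open>a\<^sub>k\<close> in place even if the number coded is \<open>0\<close>; that point delimits the code at the
  place before.
\<close>
definition decode :: "nat set \<Rightarrow> nat \<Rightarrow> nat" where
  "decode x k = (LEAST j. nth_elt (column x (nth_elt {a. column x a \<noteq> {}} (Suc k))) 0
                   \<le> nth_elt (column x (nth_elt {a. column x a \<noteq> {}} k)) (Suc j))"

text \<open>
  Only finitely many points of each column are affected by the coding: once column \<open>a\<^sub>k\<close> begins at \<open>m k\<close>,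
  keep the first \<open>h k + 1\<close> of its points, let column \<open>a\<^sub>k\<^sub>+\<^sub>1\<close> begin at some point \<open>m (k + 1)\<close> beyond them, and
  delete from column \<open>a\<^sub>k\<close> the other points below \<open>m (k + 1)\<close>. Since the columns are infinite, this
  never gets stuck, whatever they are.
\<close>
lemma thin_to_code:
  assumes u: "infinite u" and y: "\<And>a. a \<in> u \<Longrightarrow> infinite (y a)"
  obtains x where "{a. column x a \<noteq> {}} = u" "\<And>a. a \<in> u \<Longrightarrow> column x a \<subseteq> y a"
    "\<And>a. a \<in> u \<Longrightarrow> finite (y a - column x a)" "decode x = h"
proof -
  define z where "z k = y (enumerate u k)" for k
  have z: "infinite (z k)" for k
    unfolding z_def by (intro y enumerate_in_set u)
  define e where "e k = enumerate (z k)" for k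
  have e: "strict_mono (e k)" for k
    unfolding e_def by (intro strict_monoI enumerate_mono z)
  have range_e: "range (e k) = z k" for k
    unfolding e_def by (rule range_enumerate[OF z])
  \<comment> \<open>\<open>e k\<close> enumerates the \<open>k\<close>-th column, and \<open>s k\<close> is the position in it of the first point that is
    kept. An increasing enumeration is at least the identity, so position \<open>s (k + 1)\<close> lies beyond
    all points that column \<open>k\<close> keeps for the code.\<close>
  define s where "s = rec_nat 0 (\<lambda>k p. Suc (e k (p + h k)))"
  define m where "m k = e k (s k)" for k
  define c where "c k = e k ` {s k..s k + h k} \<union> {b \<in> z k. m (Suc k) \<le> b}" for k
  have gap: "e k (s k + h k) < m (Suc k)" for k
  proof -
    have "e k (s k + h k) < s (Suc k)" by (simp add: s_def)
    also have "\<dots> \<le> m (Suc k)" unfolding m_def by (rule strict_mono_imp_increasing[OF e])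
    finally show ?thesis .
  qed
  have e_in: "e k i \<in> z k" for k i
    unfolding range_e[symmetric] by (rule rangeI)
  have c_sub: "c k \<subseteq> z k" for k
    by (auto simp: c_def e_in)
  have c_above: "\<exists>i\<ge>s k. b = e k i" if "b \<in> c k" for b k
  proof -
    have "b \<in> range (e k)"
      using that c_sub[of k] unfolding range_e by (rule rev_subsetD)
    then obtain i where i: "b = e k i" ..
    have "s k \<le> i"
    proof (rule ccontr)
      assume "\<not> s k \<le> i"
      then have "b < e k (s k + h k)" unfolding i by (simp add: strict_mono_less[OF e])
      with gap[of k] have "b < m (Suc k)" by simp
      with that \<open>\<not> s k \<le> i\<close> i show False
        unfolding c_def by (auto simp: strict_mono_eq[OF e])
    qed
    with i show ?thesis by blast
  qed
  have nth_c: "nth_elt (c k) j = e k (s k + j)" if "j \<le> h k" for k j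
    by (rule nth_elt_segment[OF e c_above _ that]) (auto simp: c_def)
  have c_fin: "finite (z k - c k)" for k
    by (rule finite_subset[of _ "{..<m (Suc k)}"]) (auto simp: c_def)
  have inf_c: "infinite (c k)" for k
    using Diff_infinite_finite[OF _ z[of k]] c_fin[of k] by blast
  have nth_c': "m (Suc k) \<le> nth_elt (c k) (Suc (h k))" for k
  proof -
    obtain b where "b \<in> c k" "e k (s k + h k) < b"
      using inf_c[of k] unfolding infinite_nat_iff_unbounded by blast
    then have b: "b \<in> c k \<and> e k (s k + h k) < b" ..
    have "nth_elt (c k) (Suc (h k)) = (LEAST b. b \<in> c k \<and> e k (s k + h k) < b)"
      using nth_elt_simps(2)[of "c k" "h k"] nth_c[of "h k" k] by simp
    with LeastI[of "\<lambda>b. b \<in> c k \<and> e k (s k + h k) < b", OF b]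
    have "nth_elt (c k) (Suc (h k)) \<in> c k" "e k (s k + h k) < nth_elt (c k) (Suc (h k))"
      by simp_all
    then show ?thesis
      unfolding c_def by (auto simp: strict_mono_less[OF e])
  qed
  define x where "x = {prod_encode (enumerate u k, b) | k b. b \<in> c k}"
  have col: "column x (enumerate u k) = c k" for k
    using inj_enumerate[OF u] unfolding column_def x_def by (auto simp: inj_eq)
  have ex_k: "\<exists>k. a = enumerate u k" if "a \<in> u" for a
    using range_enumerate[OF u] that by blast
  show thesis
  proof
    have "column x a = {}" if "a \<notin> u" for a
      using that enumerate_in_set[OF u] unfolding column_def x_def by auto
    moreover have "column x a \<noteq> {}" if "a \<in> u" for a
      using ex_k[OF that] col inf_c by (metis finite.emptyI)
    ultimately show supp: "{a. column x a \<noteq> {}} = u" by blast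
    show "column x a \<subseteq> y a" if "a \<in> u" for a
      using ex_k[OF that] col c_sub unfolding z_def by auto
    show "finite (y a - column x a)" if "a \<in> u" for a
      using ex_k[OF that] col c_fin unfolding z_def by auto
    show "decode x = h"
    proof
      fix k
      have "m (Suc k) = nth_elt (c (Suc k)) 0" by (simp add: nth_c m_def)
      then have "decode x k = (LEAST j. m (Suc k) \<le> nth_elt (c k) (Suc j))"
        unfolding decode_def supp by (simp add: nth_elt_eq_enumerate[OF u] col)
      also have "\<dots> = h k"
      proof (rule Least_equality)
        show "m (Suc k) \<le> nth_elt (c k) (Suc (h k))" by (rule nth_c')
      next
        fix j assume j: "m (Suc k) \<le> nth_elt (c k) (Suc j)"
        show "h k \<le> j"
        proof (rule ccontr)
          assume "\<not> h k \<le> j"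
          then have "nth_elt (c k) (Suc j) \<le> e k (s k + h k)"
            by (simp add: nth_c strict_mono_less_eq[OF e])
          with j gap[of k] show False by simp
        qed
      qed
      finally show "decode x k = h k" .
    qed
  qed
qed

section \<open>The decoding is arithmetical\<close>

lemma arith_fun_prod_encode:
  assumes "arith_fun a" "arith_fun b"
  shows "arith_fun (\<lambda>F. prod_encode (a F, b F))"
  unfolding prod_encode_def triangle_def split_conv
  by (intro arith_intros arith_fun_div assms)

lemma arith_fun_nth_elt:
  assumes "arith_rel (\<lambda>F. A (F 0 0) (shift F))" "arith_fun k"
  shows "arith_fun (\<lambda>F. nth_elt {b. A b F} (k F))"
  unfolding nth_elt_def mem_Collect_eq
proof (rule arith_fun_rec[OF _ _ assms(2)])
  show "arith_fun (\<lambda>F. LEAST b. A b F)" by (rule arith_fun_Least[OF assms(1)])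
  have "arith_rel (\<lambda>F. A (F 0 0) (\<lambda>i. F (Suc (Suc (Suc i)))))"
    using arith_rename[OF assms(1), of "case_nat 0 (\<lambda>i. Suc (Suc (Suc i)))"] by simp
  then have "arith_rel (\<lambda>F. A (F 0 0) (\<lambda>i. F (Suc (Suc (Suc i)))) \<and> F (Suc 1) 0 < F 0 0)"
    by (intro arith_conj arith_less arith_fun_app arith_fun_const)
  then show "arith_fun (\<lambda>F. LEAST b. A b (\<lambda>i. F (Suc (Suc i))) \<and> F 1 0 < b)"
    by (rule arith_fun_Least[where P = "\<lambda>b F. A b (\<lambda>i. F (Suc (Suc i))) \<and> F 1 0 < b"])
qed

lemma arith_fun_decode:
  assumes "arith_fun k"
  shows "arith_fun (\<lambda>F. decode {t. F i t \<noteq> 0} (k F))"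
proof -
  have "arith_fun (\<lambda>F. decode {t. F (Suc i) t \<noteq> 0} (F 0 0))"
    unfolding decode_def column_def mem_Collect_eq Collect_empty_eq
    by (intro arith_fun_Least arith_le arith_fun_nth_elt arith_all arith_not arith_eq
        arith_fun_app arith_fun_const arith_fun_prod_encode arith_fun_Suc)
  then show ?thesis
    by (rule arith_fun_subst[where c = "\<lambda>m F. decode {t. F i t \<noteq> 0} m", OF _ assms])
qed

section \<open>From a base to an ultrafilter\<close>

text \<open>
  The ultrafilter generated by \<open>X\<close> consists of the supersets of members of \<open>X\<close>, and also, by
  maximality, of the sets that meet every member of \<open>X\<close>. The first description has an existential
  and the second a universal set quantifier in front.
\<close>
lemma Delta1_of_Pi1_base:
  assumes X: "X \<in> Pi1 n r" and base: "ultrafilter_base X U"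
  shows "U \<in> Delta1 (n + 1) r"
proof -
  have U: "omega_ultrafilter U" and XU: "X \<subseteq> U" and cof: "\<And>u. u \<in> U \<Longrightarrow> \<exists>x\<in>X. x \<subseteq> u"
    using base unfolding ultrafilter_base_def by auto
  have U_iff: "u \<in> U \<longleftrightarrow> (\<exists>x\<in>X. x \<subseteq> u)" for u
    using cof XU ultrafilter_mono[OF U] by blast
  obtain Q where Q: "pi_rel n Q" "\<And>x. x \<in> X \<longleftrightarrow> Q (case_nat (indicator x) (\<lambda>_. indicator r))"
    using X unfolding Pi1_iff by blast
  \<comment> \<open>Quantifiers range over all functions; a function \<open>f\<close> stands for the set \<open>{t. f t \<noteq> 0}\<close>.\<close>
  define G :: "fenv \<Rightarrow> fenv"
    where "G F = case_nat (\<lambda>t. if F 0 t \<noteq> 0 then 1 else 0) (\<lambda>_. F (Suc (Suc 0)))" for F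
  have "arith_map G"
    unfolding G_def by (intro arith_map_case_nat arith_map_rename[where \<rho> = "\<lambda>_. Suc (Suc 0)"])
      (intro arith_fun_if arith_intros)
  then have QG: "pi_rel n (Q \<circ> G)" by (rule pi_rel_comp[OF Q(1)])
  have QG_iff: "(Q \<circ> G) (case_nat f (case_nat g (\<lambda>_. indicator r))) \<longleftrightarrow> {t. f t \<noteq> 0} \<in> X" for f g
  proof -
    have "(\<lambda>t. if f t \<noteq> 0 then 1 else 0) = (indicator {t. f t \<noteq> 0} :: nat \<Rightarrow> nat)"
      by (auto simp: indicator_def)
    then show ?thesis by (simp add: G_def Q(2) del: neq0_conv)
  qed
  have ex_set: "(\<exists>f::nat \<Rightarrow> nat. R {t. f t \<noteq> 0}) \<longleftrightarrow> (\<exists>x. R x)" for R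
    by (metis (mono_tags, lifting) Collect_mem_eq indicator_eq_0_iff Collect_cong)
  have "arith_rel (\<lambda>F. \<forall>t. F 0 t \<noteq> 0 \<longrightarrow> F 1 t \<noteq> 0)" "arith_rel (\<lambda>F. \<forall>t. F 0 t \<noteq> 0 \<longrightarrow> F 1 t = 0)"
    by (intro arith_intros)+
  note S = this[THEN pi_rel_conj_arith[OF QG]]
  have "- U \<in> Pi1 (n + 1) r"
    unfolding Pi1_iff
  proof (intro exI conjI allI)
    let ?P = "\<lambda>F. \<forall>f. \<not> ((Q \<circ> G) (case_nat f F) \<and> (\<forall>t. case_nat f F 0 t \<noteq> 0 \<longrightarrow> case_nat f F 1 t \<noteq> 0))"
    show "pi_rel (n + 1) ?P"
      unfolding Suc_eq_plus1[symmetric] pi_rel.simps by (rule exI, rule conjI[OF S(1)]) simp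
    fix u
    show "u \<in> - U \<longleftrightarrow> ?P (case_nat (indicator u) (\<lambda>_. indicator r))"
      using ex_set[of "\<lambda>x. x \<in> X \<and> x \<subseteq> u"] unfolding QG_iff
      by (simp add: U_iff subset_iff indicator_eq_0_iff) blast
  qed
  moreover have "U \<in> Pi1 (n + 1) r"
    unfolding Pi1_iff
  proof (intro exI conjI allI)
    let ?P = "\<lambda>F. \<forall>f. \<not> ((Q \<circ> G) (case_nat f F) \<and> (\<forall>t. case_nat f F 0 t \<noteq> 0 \<longrightarrow> case_nat f F 1 t = 0))"
    show "pi_rel (n + 1) ?P"
      unfolding Suc_eq_plus1[symmetric] pi_rel.simps by (rule exI, rule conjI[OF S(2)]) simp
    fix u
    have "u \<in> U \<longleftrightarrow> \<not> (\<exists>x\<in>X. x \<subseteq> - u)"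
      using ultrafilter_Compl[OF U, of u] U_iff by blast
    then show "u \<in> U \<longleftrightarrow> ?P (case_nat (indicator u) (\<lambda>_. indicator r))"
      using ex_set[of "\<lambda>x. x \<in> X \<and> x \<subseteq> - u"] unfolding QG_iff
      by (simp add: subset_iff indicator_eq_0_iff) blast
  qed
  ultimately show ?thesis
    by (simp add: Delta1_def Sigma1_iff)
qed

section \<open>From an ultrafilter to a base\<close>

text \<open>
  The function \<open>decode x\<close> is split into countably many rows, and each row into a set (even places)
  and a function (odd places).
\<close>
definition coded_set :: "nat set \<Rightarrow> nat \<Rightarrow> nat set" where
  "coded_set x i = {t. decode x (prod_encode (i, 2 * t)) \<noteq> 0}"

definition coded_fun :: "nat set \<Rightarrow> nat \<Rightarrow> nat \<Rightarrow> nat" where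
  "coded_fun x i t = decode x (prod_encode (i, Suc (2 * t)))"

text \<open>
  Row \<open>0\<close> supplies a set of column indices and row \<open>a + 1\<close> a set almost contained in column \<open>a\<close>, each
  together with a witness in the sense of \<open>W\<close>. The witnesses are for the supplied sets and not for the
  columns of \<open>x\<close> themselves: writing the witnesses into \<open>x\<close> changes its columns, but only by
  finitely many points, so the two requirements do not interfere.
\<close>
definition coded_base :: "(nat set \<Rightarrow> (nat \<Rightarrow> nat) \<Rightarrow> bool) \<Rightarrow> nat set set" where
  "coded_base W = {x. (\<forall>i. W (coded_set x i) (coded_fun x i)) \<and>
     (\<forall>a. a \<in> coded_set x 0 \<longrightarrow> (\<exists>d. \<forall>b. d \<le> b \<longrightarrow> b \<in> coded_set x (Suc a) \<longrightarrow> b \<in> column x a))}"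

text \<open>
  A member of \<open>coded_base W\<close> carries a proof of its membership in the Fubini square. Conversely, below
  any \<open>y\<close> in the Fubini square, the columns that lie in \<open>U\<close> can be thinned so as to code witnesses
  for themselves.
\<close>
lemma coded_base_fubini_square:
  assumes U: "omega_ultrafilter U" and W: "\<And>u. u \<in> U \<longleftrightarrow> (\<exists>f. W u f)"
  shows "ultrafilter_base (coded_base W) (fubini_square U)"
  unfolding ultrafilter_base_def
proof (intro conjI omega_ultrafilter_fubini_square U subsetI ballI)
  fix x assume x: "x \<in> coded_base W"
  then have coded: "coded_set x i \<in> U" for i
    unfolding coded_base_def W by blast
  have "column x a \<in> U" if "a \<in> coded_set x 0" for a
  proof -
    have "\<exists>d. \<forall>b. d \<le> b \<longrightarrow> b \<in> coded_set x (Suc a) \<longrightarrow> b \<in> column x a"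
      using x that unfolding coded_base_def by simp
    then obtain d where "\<forall>b. d \<le> b \<longrightarrow> b \<in> coded_set x (Suc a) \<longrightarrow> b \<in> column x a" ..
    then have "coded_set x (Suc a) - column x a \<subseteq> {..<d}"
      by (auto simp: not_le[symmetric])
    then show ?thesis
      using ultrafilter_almost_mono[OF U coded] finite_subset finite_lessThan by blast
  qed
  then have "coded_set x 0 \<subseteq> {a. column x a \<in> U}" by blast
  then show "x \<in> fubini_square U"
    unfolding fubini_square_def using ultrafilter_mono[OF U coded] by blast
next
  fix y assume "y \<in> fubini_square U"
  define u where "u = {a. column y a \<in> U}"
  have u: "u \<in> U" using \<open>y \<in> fubini_square U\<close> unfolding u_def fubini_square_def by blast
  have "UNIV \<in> U" using ultrafilter_cofinite[OF U] by simp
  \<comment> \<open>Rows of indices outside \<open>u\<close> must carry a member of \<open>U\<close> too; any member will do.\<close>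
  define Y where "Y i = (case i of 0 \<Rightarrow> u | Suc a \<Rightarrow> if a \<in> u then column y a else UNIV)" for i
  have "Y i \<in> U" for i
    using u \<open>UNIV \<in> U\<close> by (auto simp: Y_def u_def split: nat.split)
  then obtain g where g: "\<And>i. W (Y i) (g i)" unfolding W by metis
  define h where "h k = (case prod_decode k of (i, t) \<Rightarrow>
    if even t then indicator (Y i) (t div 2) else g i (t div 2))" for k
  obtain x where x: "{a. column x a \<noteq> {}} = u" "\<And>a. a \<in> u \<Longrightarrow> column x a \<subseteq> column y a"
    "\<And>a. a \<in> u \<Longrightarrow> finite (column y a - column x a)" "decode x = h"
    using thin_to_code[of u "column y" h] ultrafilter_infinite[OF U] u unfolding u_def by blast
  have Y: "coded_set x i = Y i" for i
    by (auto simp: coded_set_def x(4) h_def indicator_eq_0_iff simp del: neq0_conv)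
  have g': "coded_fun x i = g i" for i
    by (auto simp: coded_fun_def x(4) h_def)
  have "\<exists>d. \<forall>b. d \<le> b \<longrightarrow> b \<in> column y a \<longrightarrow> b \<in> column x a" if "a \<in> u" for a
    using x(3)[OF that] unfolding finite_nat_set_iff_bounded by (meson DiffI not_le)
  then have "x \<in> coded_base W"
    using g by (simp add: coded_base_def Y g' Y_def)
  moreover have "x \<subseteq> y"
  proof
    fix t assume "t \<in> x"
    obtain a b where t: "t = prod_encode (a, b)" by (metis prod_decode_inverse surj_pair)
    then have "b \<in> column x a" using \<open>t \<in> x\<close> by (simp add: column_def)
    then have "b \<in> column y a" using x(1,2) by blast
    then show "t \<in> y" by (simp add: column_def t)
  qed
  ultimately show "\<exists>x\<in>coded_base W. x \<subseteq> y" by blast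
qed

lemma coded_base_Pi1:
  assumes Q: "pi_rel n Q"
  shows "coded_base (\<lambda>u f. Q (case_nat f (case_nat (indicator u) (\<lambda>_. indicator r)))) \<in> Pi1 n r"
    (is "coded_base ?W \<in> _")
proof -
  define G :: "fenv \<Rightarrow> fenv" where "G F = case_nat
      (\<lambda>t. decode {t. F (Suc 0) t \<noteq> 0} (prod_encode (F 0 0, Suc (2 * t))))
      (case_nat (\<lambda>t. if decode {t. F (Suc 0) t \<noteq> 0} (prod_encode (F 0 0, 2 * t)) \<noteq> 0 then 1 else 0)
        (\<lambda>_. F (Suc (Suc 0))))" for F
  have "arith_map G"
    unfolding G_def
    by (intro arith_map_case_nat arith_map_rename[where \<rho> = "\<lambda>_. Suc (Suc 0)"])
      (intro arith_fun_if arith_fun_decode arith_fun_prod_encode arith_intros)+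
  then have QG: "pi_rel n (Q \<circ> G)" by (rule pi_rel_comp[OF Q])
  define A where "A F \<longleftrightarrow> (\<forall>a. decode {t. F 0 t \<noteq> 0} (prod_encode (0, 2 * a)) \<noteq> 0 \<longrightarrow>
    (\<exists>d. \<forall>b. d \<le> b \<longrightarrow> decode {t. F 0 t \<noteq> 0} (prod_encode (Suc a, 2 * b)) \<noteq> 0 \<longrightarrow>
      F 0 (prod_encode (a, b)) \<noteq> 0))" for F :: fenv
  have "arith_rel A"
    unfolding A_def by (intro arith_intros arith_fun_decode arith_fun_prod_encode)
  show ?thesis
    unfolding Pi1_iff
  proof (intro exI conjI allI)
    show "pi_rel n (\<lambda>F. (\<forall>i. (Q \<circ> G) (case_nat (\<lambda>_. i) F)) \<and> A F)"
      by (rule pi_rel_conj_arith[OF pi_rel_all_number[OF QG] \<open>arith_rel A\<close>])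
    fix x
    let ?E = "case_nat (indicator x) (\<lambda>_. indicator r) :: fenv"
    have S: "{t. indicator x t \<noteq> (0::nat)} = x" by (simp add: indicator_eq_0_iff)
    have "(Q \<circ> G) (case_nat (\<lambda>_. i) ?E) \<longleftrightarrow> ?W (coded_set x i) (coded_fun x i)" for i
    proof -
      have "(\<lambda>t. if decode x (prod_encode (i, 2 * t)) \<noteq> 0 then 1 else 0)
          = (indicator (coded_set x i) :: nat \<Rightarrow> nat)"
        by (auto simp: coded_set_def indicator_def)
      moreover have "(\<lambda>t. decode x (prod_encode (i, Suc (2 * t)))) = coded_fun x i"
        by (auto simp: coded_fun_def)
      ultimately show ?thesis
        unfolding comp_def G_def by (simp add: S del: mult_Suc neq0_conv)
    qed
    moreover have "A ?E \<longleftrightarrow> (\<forall>a. a \<in> coded_set x 0 \<longrightarrow>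
        (\<exists>d. \<forall>b. d \<le> b \<longrightarrow> b \<in> coded_set x (Suc a) \<longrightarrow> b \<in> column x a))"
      unfolding A_def coded_set_def column_def by (simp add: S indicator_eq_0_iff)
    ultimately show "x \<in> coded_base ?W \<longleftrightarrow> (\<forall>i. (Q \<circ> G) (case_nat (\<lambda>_. i) ?E)) \<and> A ?E"
      unfolding coded_base_def by simp
  qed
qed

theorem theorem1p4:
  fixes r :: "nat set" and n :: nat
  shows "(\<exists>U. omega_ultrafilter U \<and> U \<in> Delta1 (n + 1) r) \<longleftrightarrow>
         (\<exists>X. X \<in> Pi1 n r \<and> (\<exists>U. ultrafilter_base X U))"
proof
  assume "\<exists>U. omega_ultrafilter U \<and> U \<in> Delta1 (n + 1) r"
  then obtain U where U: "omega_ultrafilter U" "- U \<in> Pi1 (Suc n) r"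
    by (auto simp: Delta1_def Sigma1_iff)
  then obtain Q where Q: "pi_rel n Q"
    "\<And>u. u \<notin> U \<longleftrightarrow> (\<forall>f. \<not> Q (case_nat f (case_nat (indicator u) (\<lambda>_. indicator r))))"
    unfolding Pi1_iff by auto
  have "u \<in> U \<longleftrightarrow> (\<exists>f. Q (case_nat f (case_nat (indicator u) (\<lambda>_. indicator r))))" for u
    using Q(2)[of u] by blast
  with U(1) have "ultrafilter_base
      (coded_base (\<lambda>u f. Q (case_nat f (case_nat (indicator u) (\<lambda>_. indicator r))))) (fubini_square U)"
    by (rule coded_base_fubini_square)
  with coded_base_Pi1[OF Q(1), of r] show "\<exists>X. X \<in> Pi1 n r \<and> (\<exists>U. ultrafilter_base X U)"
    by blast
next
  assume "\<exists>X. X \<in> Pi1 n r \<and> (\<exists>U. ultrafilter_base X U)"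
  then show "\<exists>U. omega_ultrafilter U \<and> U \<in> Delta1 (n + 1) r"
    using Delta1_of_Pi1_base unfolding ultrafilter_base_def by blast
qed

end
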